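(* Let $P = \{x_1, \ldots, x_d\}$ be a finite partially ordered set with $|P| = d \geq 1$. The order polytope $\mathcal{O}(P) \subset \mathbb{R}^d$ and the chain polytope $\mathcal{C}(P) \subset \mathbb{R}^d$ are unimodularly equivalent if and only if the five-element poset $X$ (defined in the context) does not appear as a subposet of $P$, i.e. there do not exist elements $a, b, c, p, q \in P$ such that $a < c$, $b < c$, $c < p$, $c < q$, $a$ and $b$ are incomparable, and $p$ and $q$ are incomparable.
   Context: The order polytope $\mathcal{O}(P)$ is the set of all $(a_1, \ldots, a_d) \in \mathbb{R}^d$ with $0 \leq a_i \leq 1$ for every $i$ and $a_i \geq a_j$ whenever $x_i \leq x_j$ in $P$. The chain polytope $\mathcal{C}(P)$ is the set of all $(a_1, \ldots, a_d) \in \mathbb{R}^d$ with $a_i \geq 0$ for every $i$ and $a_{i_1} + a_{i_2} + \cdots + a_{i_k} \leq 1$ for every maximal chain $x_{i_1} < x_{i_2} < \cdots < x_{i_k}$ of $P$. Both are integral convex polytopes of dimension $d$. Two integral polytopes $\mathcal{P}, \mathcal{Q} \subset \mathbb{R}^d$ of dimension $d$ are unimodularly equivalent if there exist a matrix $U \in \mathbb{Z}^{d \times d}$ with $\det(U) = \pm 1$ and a vector $\mathbf{w} \in \mathbb{Z}^d$ such that $\mathcal{Q} = f_U(\mathcal{P}) + \mathbf{w}$, where $f_U(\mathbf{v}) = \mathbf{v} U$ for all $\mathbf{v} \in \mathbb{R}^d$ (row vectors). The poset $X$ has five elements $a, b, c, p, q$; its cover relations are $a < c$, $b < c$, $c <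 p$, $c < q$ (so $a, b$ are incomparable minimal elements, $p, q$ are incomparable maximal elements, and $c$ lies between them). "Subposet" means induced subposet: a subset of $P$ with the order induced from $P$. *)

theory Defs
  imports "HOL-Analysis.Analysis"
begin

text \<open>
  A finite poset on \<open>d \<ge> 1\<close> elements is a type \<open>'n\<close> of class \<open>finite\<close> and \<open>order\<close>; the
  coordinates of \<open>\<real>\<^sup>d\<close> are indexed by the poset elements themselves.
\<close>

definition order_polytope :: "(real ^ 'n::{finite,order}) set" where
  "order_polytope =
     {a. (\<forall>i. 0 \<le> a $ i \<and> a $ i \<le> 1) \<and> (\<forall>i j. i \<le> j \<longrightarrow> a $ i \<ge> a $ j)}"

definition chain_polytope :: "(real ^ 'n::{finite,order}) set" where
  "chain_polytope =
     {a. (\<forall>i. 0 \<le> a $ i) \<and>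
         (\<forall>C. pred_on.maxchain UNIV (<) C \<longrightarrow> (\<Sum>i\<in>C. a $ i) \<le> 1)}"

text \<open>
  In the literature this relation is defined between full-dimensional integral polytopes;
  here it is totalised to arbitrary sets by the same formula. Vectors are row vectors,
  so \<open>U\<close> acts from the right.
\<close>

definition unimodularly_equivalent :: "(real ^ 'n) set \<Rightarrow> (real ^ 'n) set \<Rightarrow> bool" where
  "unimodularly_equivalent P Q \<longleftrightarrow>
     (\<exists>(U :: int ^ 'n ^ 'n) (w :: int ^ 'n).
        (det U = 1 \<or> det U = - 1) \<and>
        Q = (\<lambda>v. v v* map_matrix real_of_int U + (\<chi> i. real_of_int (w $ i))) ` P)"

end

theory Submission
  imports Defs
begin

text \<open>
  The Hasse diagram of \<open>P\<close>, with a bottom and a top adjoined, has one edge for each facet inequality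
  of the order polytope, while the inequalities of the chain polytope are the \<open>d\<close> signs and the sums
  over maximal chains, i.e. over the paths from bottom to top.

  \<^bold>\<open>Necessity.\<close> An affine bijection preserves the number of facets.  This is
  used in an elementary form: beyond each inequality of the chain polytope there is an outer point
  such that the midpoint of any two of these points lies in the polytope
  (\<open>chain_polytope_outer_family\<close>).  An affine bijection carries this family to the order polytope,
  where by the pigeonhole principle such a family has at most one member per edge
  (\<open>card_outer_family_order_polytope\<close>).  Hence \<open>d\<close> plus the number of maximal chains is at most
  the number of edges.  On the other hand, choosing one incoming edge per element gives a spanning
  tree with \<open>d\<close> edges inside the diagram, and
  every other edge is the first nontree edge of some maximal chain.  If \<open>a, b < c < p, q\<close> form
  the poset \<open>X\<close>, one of these edges is shared by two chains, which afterwards pass through \<open>p\<close>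
  and through \<open>q\<close> respectively; so there are more maximal chains than nontree edges
  (\<open>card_hat_edges_less\<close>), a contradiction.

  \<^bold>\<open>Sufficiency.\<close> If \<open>X\<close> does not occur, each element has a chain strictly below it or a chain
  strictly above it.  The elements \<open>D\<close> of the first kind form a down-set in which every element has
  a unique lower edge; outside \<open>D\<close> every element has a unique upper edge.  Let \<open>b\<^sub>i\<close> be the
  difference of the coordinates of \<open>a\<close> along that edge, where the bottom has coordinate \<open>1\<close> and the
  top has coordinate \<open>0\<close>.  The sum of \<open>b\<close> over the elements up to \<open>r \<in> D\<close> telescopes to
  \<open>1 - a\<^sub>r\<close>, and the sum over the elements from \<open>s \<notin> D\<close> on telescopes to \<open>a\<^sub>s\<close>.  Thus \<open>b \<ge> 0\<close>
  expresses the order inequalities along the edges within the two parts, and the chain inequality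
  of a chain that leaves \<open>D\<close> along the edge from \<open>r\<close> to \<open>s\<close> expresses
  \<open>a\<^sub>s \<le> a\<^sub>r\<close>.  The telescoped sums also show that the linear part has an integral inverse.
\<close>

section \<open>Chains in a finite poset\<close>

abbreviation is_chain :: "'a::order set \<Rightarrow> bool" where
  "is_chain C \<equiv> \<forall>x\<in>C. \<forall>y\<in>C. x \<le> y \<or> y \<le> x"

abbreviation maximal_chains :: "'a::order set set" where
  "maximal_chains \<equiv> {K. pred_on.maxchain UNIV (<) K}"

lemma chain_iff_is_chain: "pred_on.chain UNIV (<) C \<longleftrightarrow> is_chain C"
  unfolding pred_on.chain_def by (fastforce simp: less_le)

lemma maximal_chain_iff:
  "pred_on.maxchain UNIV (<) K \<longleftrightarrow> is_chain K \<and> (\<forall>L. is_chain L \<and> K \<subseteq> L \<longrightarrow> L = K)"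
  unfolding pred_on.maxchain_def chain_iff_is_chain by blast

lemma chain_extends_to_maximal:
  fixes C :: "'a::{finite,order} set"
  assumes "is_chain C"
  obtains K where "K \<in> maximal_chains" "C \<subseteq> K"
proof -
  obtain K where "is_chain K" "C \<subseteq> K" "\<forall>L. is_chain L \<and> K \<subseteq> L \<longrightarrow> K = L"
    using finite_has_maximal2[of "{L. is_chain L}" C] assms by auto
  then show thesis using that by (simp add: maximal_chain_iff) metis
qed

lemma finite_order_less_induct [case_names less]:
  fixes i :: "'a::{finite,order}"
  assumes "\<And>i. (\<And>j. j < i \<Longrightarrow> Q j) \<Longrightarrow> Q i"
  shows "Q i"
proof (induction i rule: measure_induct_rule[where f = "\<lambda>i. card {..<i}"])
  case (less i)
  show ?case
  proof (rule assms, rule less)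
    show "card {..<j} < card {..<i}" if "j < i" for j
      using that by (intro psubset_card_mono) auto
  qed
qed

lemma finite_order_greater_induct [case_names greater]:
  fixes i :: "'a::{finite,order}"
  assumes "\<And>i. (\<And>j. i < j \<Longrightarrow> Q j) \<Longrightarrow> Q i"
  shows "Q i"
proof (induction i rule: measure_induct_rule[where f = "\<lambda>i. card {i<..}"])
  case (less i)
  show ?case
  proof (rule assms, rule less)
    show "card {j<..} < card {i<..}" if "i < j" for j
      using that by (intro psubset_card_mono) auto
  qed
qed

section \<open>The Hasse diagram with a bottom and a top adjoined\<close>

text \<open>
  In the source position \<open>None\<close> is the adjoined bottom, in the target position it is the
  adjoined top.  With this convention the edges are exactly the facet inequalities of the order
  polytope: cover relations, upper bounds at minimal elements and lower bounds at maximal ones.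
\<close>

fun hat_edge :: "'a::order option \<Rightarrow> 'a option \<Rightarrow> bool" where
  "hat_edge None None = False"
| "hat_edge None (Some j) = (\<forall>k. \<not> k < j)"
| "hat_edge (Some i) None = (\<forall>k. \<not> i < k)"
| "hat_edge (Some i) (Some j) = (i < j \<and> (\<forall>k. \<not> (i < k \<and> k < j)))"

abbreviation hat_edges :: "('a::order option \<times> 'a option) set" where
  "hat_edges \<equiv> {(x, y). hat_edge x y}"

lemma cover_below:
  fixes i j :: "'a::{finite,order}"
  assumes "i < j"
  obtains k where "i \<le> k" "hat_edge (Some k) (Some j)"
proof -
  obtain k where "i \<le> k" "k < j" "\<And>l. i \<le> l \<Longrightarrow> l < j \<Longrightarrow> k \<le> l \<Longrightarrow> k = l"
    using finite_has_maximal2[of "{l. i \<le> l \<and> l < j}" i] assms by auto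
  moreover from this have "hat_edge (Some k) (Some j)" by (auto simp: less_le)
  ultimately show thesis using that by blast
qed

lemma cover_above:
  fixes i j :: "'a::{finite,order}"
  assumes "i < j"
  obtains k where "k \<le> j" "hat_edge (Some i) (Some k)"
proof -
  obtain k where "k \<le> j" "i < k" "\<And>l. l \<le> j \<Longrightarrow> i < l \<Longrightarrow> l \<le> k \<Longrightarrow> k = l"
    using finite_has_minimal2[of "{l. l \<le> j \<and> i < l}" j] assms by (auto simp: less_imp_le)
  moreover from this have "hat_edge (Some i) (Some k)"
    by (auto simp: less_le) (metis order_trans)
  ultimately show thesis using that by blast
qed

lemma ex_hat_edge_below: "\<exists>x. hat_edge x (Some (j :: 'a::{finite,order}))"
  by (metis cover_below hat_edge.simps(2))

lemma ex_hat_edge_above: "\<exists>y. hat_edge (Some (i :: 'a::{finite,order})) y"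
  by (metis cover_above hat_edge.simps(3))

section \<open>Counting maximal chains against edges of the Hasse diagram\<close>

text \<open>
  A choice of an incoming edge at every element spans a tree rooted at the adjoined bottom;
  \<open>branch p u\<close> is the path of this tree from the bottom to \<open>u\<close>.
\<close>

inductive_set branch :: "('a \<Rightarrow> 'a option) \<Rightarrow> 'a \<Rightarrow> 'a set" for p u where
  branch_self: "u \<in> branch p u"
| branch_parent: "x \<in> branch p u \<Longrightarrow> p x = Some y \<Longrightarrow> y \<in> branch p u"

lemma branch_unfold:
  "branch p u = insert u (case p u of None \<Rightarrow> {} | Some w \<Rightarrow> branch p w)" (is "_ = ?R")
proof
  show "branch p u \<subseteq> ?R"
  proof
    fix x assume "x \<in> branch p u"
    then show "x \<in> ?R"
      by induction (auto split: option.splits intro: branch.intros)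
  qed
  have "x \<in> branch p u" if "x \<in> branch p w" "p u = Some w" for x w
    using that by induction (auto intro: branch.intros)
  then show "?R \<subseteq> branch p u"
    by (auto split: option.splits intro: branch.intros)
qed

locale spanning_tree =
  fixes p :: "'a::{finite,order} \<Rightarrow> 'a option"
  assumes parent_edge: "hat_edge (p v) (Some v)"
begin

lemma parent_less: "p v = Some w \<Longrightarrow> w < v"
  using parent_edge[of v] by simp

lemma branch_le: "x \<in> branch p u \<Longrightarrow> x \<le> u"
  by (induction rule: branch.induct) (auto dest: parent_less)

lemma branch_chain: "is_chain (branch p u)"
proof (induction u rule: finite_order_less_induct)
  case (less u)
  show ?case
  proof (cases "p u")
    case None
    then show ?thesis by (simp add: branch_unfold[of p u])
  next
    case (Some w)
    then have "is_chain (branch p w)" "\<And>x. x \<in> branch p w \<Longrightarrow> x \<le> u"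
      using less parent_less branch_le by (blast, meson order.strict_implies_order order_trans)
    then show ?thesis using Some by (auto simp: branch_unfold[of p u])
  qed
qed

text \<open>
  Consecutive elements of a branch are covers, so nothing can be inserted between them.
\<close>

lemma branch_saturated:
  assumes "x \<le> u" "\<And>z. z \<in> branch p u \<Longrightarrow> x \<le> z \<or> z \<le> x"
  shows "x \<in> branch p u"
  using assms
proof (induction u rule: finite_order_less_induct)
  case (less u)
  show ?case
  proof (cases "x = u")
    case True
    then show ?thesis by (simp add: branch_self)
  next
    case False
    then have "x < u" using less.prems by simp
    then obtain w where w: "p u = Some w"
      using parent_edge[of u] by (cases "p u") auto
    then have "w \<in> branch p u" by (auto intro: branch.intros)
    then have "x \<le> w"
      using less.prems(2) parent_edge[of u] w \<open>x < u\<close> by (auto simp: less_le)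
    moreover have "branch p w \<subseteq> branch p u" using w by (auto simp: branch_unfold[of p u])
    ultimately show ?thesis using less.IH[of w] less.prems(2) parent_less w by blast
  qed
qed

abbreviation tree_edges :: "('a option \<times> 'a option) set" where
  "tree_edges \<equiv> range (\<lambda>v. (p v, Some v))"

abbreviation nontree_edges :: "('a option \<times> 'a option) set" where
  "nontree_edges \<equiv> hat_edges - tree_edges"

lemma card_hat_edges: "card (hat_edges :: ('a option \<times> 'a option) set) = CARD('a) + card nontree_edges"
proof -
  have "card tree_edges = CARD('a)" by (intro card_image) (auto intro: injI)
  moreover have "tree_edges \<subseteq> hat_edges" using parent_edge by auto
  ultimately show ?thesis
    using card_Diff_subset[of tree_edges hat_edges] card_mono[of hat_edges tree_edges] by simp
qed

lemma nontree_edge_iff: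
  "(x, y) \<in> nontree_edges \<longleftrightarrow> hat_edge x y \<and> (\<forall>v. y = Some v \<longrightarrow> p v \<noteq> x)"
  by auto

lemma nontree_edge_source:
  assumes "e \<in> nontree_edges"
  shows "\<exists>u y. e = (Some u, y)"
proof (cases e)
  case (Pair x y)
  have "x \<noteq> None"
  proof
    assume "x = None"
    then obtain v where v: "y = Some v" "\<And>k. \<not> k < v"
      using assms unfolding Pair nontree_edge_iff by (cases y) auto
    then have "p v = None" using parent_less[of v] by (cases "p v") auto
    then show False using assms \<open>x = None\<close> v unfolding Pair nontree_edge_iff by simp
  qed
  then show ?thesis using Pair by auto
qed

text \<open>A path from \<open>a\<close> to \<open>c\<close> that uses only tree edges would be part of the branch of \<open>c\<close>.\<close>

lemma nontree_edge_below:
  assumes "a \<le> c" "a \<notin> branch p c"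
  shows "\<exists>u v. (Some u, Some v) \<in> nontree_edges \<and> v \<le> c"
  using assms
proof (induction c rule: finite_order_less_induct)
  case (less c)
  then have "a < c" by (metis branch_self order.not_eq_order_implies_strict)
  then obtain w where w: "a \<le> w" "hat_edge (Some w) (Some c)" by (rule cover_below)
  show ?case
  proof (cases "p c = Some w")
    case True
    then have "a \<notin> branch p w" using less.prems by (auto simp: branch_unfold[of p c])
    then obtain u v where "(Some u, Some v) \<in> nontree_edges" "v \<le> w"
      using less.IH[of w] w by auto
    moreover have "w < c" using w by simp
    ultimately show ?thesis by (meson order.strict_implies_order order_trans)
  next
    case False
    then show ?thesis using w by (intro exI[of _ w] exI[of _ c]) (auto simp del: hat_edge.simps)
  qed
qed

text \<open>
  For a chain \<open>K\<close> and a nontree edge \<open>e\<close> this says that \<open>e\<close> is the first nontree edge of the path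
  \<open>K\<close>.  An edge into the adjoined top has no target that \<open>K\<close> could contain; then \<open>K\<close> is the branch
  of a maximal element.
\<close>

definition departs_along :: "'a set \<Rightarrow> 'a option \<times> 'a option \<Rightarrow> bool" where
  "departs_along K e \<longleftrightarrow> (\<exists>u. fst e = Some u \<and> branch p u \<subseteq> K) \<and> (\<forall>v. snd e = Some v \<longrightarrow> v \<in> K)"

lemma departs_along_Some:
  "departs_along K (Some u, y) \<longleftrightarrow> branch p u \<subseteq> K \<and> (\<forall>v. y = Some v \<longrightarrow> v \<in> K)"
  by (simp add: departs_along_def)

text \<open>
  If \<open>K\<close> departed at \<open>u\<close> along an edge to \<open>v\<close> and again at some \<open>u' > u\<close>, then \<open>v\<close> would lie on the
  branch of \<open>u'\<close>, because branches are saturated.  The parent of \<open>v\<close> would then lie in \<open>K\<close>, and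
  \<open>K\<close> has room for only one lower cover of \<open>v\<close>: the edge from \<open>u\<close> to \<open>v\<close> would be a tree edge.
\<close>

lemma departure_unique:
  assumes chain: "is_chain K"
    and e: "e \<in> nontree_edges" "departs_along K e"
    and e': "e' \<in> nontree_edges" "departs_along K e'"
  shows "e = e'"
proof -
  have main: "(Some u, y) = (Some u', y')"
    if "u \<le> u'" and E: "(Some u, y) \<in> nontree_edges" "departs_along K (Some u, y)"
      and E': "(Some u', y') \<in> nontree_edges" "departs_along K (Some u', y')" for u u' y y'
  proof (cases "u = u'")
    case True
    have "v = v'" if "y = Some v" "y' = Some v'" for v v'
    proof -
      have "v \<in> K" "v' \<in> K" using that E(2) E'(2) by (simp_all add: departs_along_Some)
      then have "v \<le> v' \<or> v' \<le> v" using chain by blast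
      moreover have "hat_edge (Some u) (Some v)" "hat_edge (Some u) (Some v')"
        using that E(1) E'(1) True by (auto simp only: nontree_edge_iff)
      ultimately show ?thesis by (auto simp: less_le)
    qed
    moreover have "hat_edge (Some u) y" "hat_edge (Some u) y'"
      using E(1) E'(1) True by (auto simp only: nontree_edge_iff)
    ultimately have "y = y'" by (cases y; cases y') auto
    then show ?thesis using True by simp
  next
    case False
    then have "u < u'" using \<open>u \<le> u'\<close> by simp
    moreover have "hat_edge (Some u) y" using E(1) by (simp only: nontree_edge_iff)
    ultimately obtain v where v: "y = Some v" by (cases y) auto
    have K: "branch p u \<subseteq> K" "branch p u' \<subseteq> K" "v \<in> K"
      using E(2) E'(2) v by (auto simp: departs_along_Some)
    have edge: "u < v" "\<And>k. u < k \<Longrightarrow> k < v \<Longrightarrow> False"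
      using \<open>hat_edge (Some u) y\<close> v by auto
    have "v \<le> u' \<or> u' \<le> v" using chain K branch_self[of u' p] by blast
    then have "v \<le> u'" using edge(2)[OF \<open>u < u'\<close>] by (auto simp: le_less)
    then have "v \<in> branch p u'" using branch_saturated chain K by blast
    moreover obtain w where w: "p v = Some w"
      using parent_edge[of v] edge(1) by (cases "p v") auto
    ultimately have "w \<in> branch p u'" by (rule branch_parent)
    then have "w \<in> K" using K(2) by (rule rev_subsetD)
    moreover have "u \<in> K" using K(1) branch_self[of u p] by (rule subsetD)
    ultimately have "w \<le> u \<or> u \<le> w" using chain by blast
    then have "w = u" using edge parent_edge[of v] w by (auto simp: less_le)
    then show ?thesis using E(1) v w by (simp only: nontree_edge_iff)
  qed
  obtain u y u' y' where [simp]: "e = (Some u, y)" "e' = (Some u', y')"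
    using nontree_edge_source[OF e(1)] nontree_edge_source[OF e'(1)] by blast
  have "u \<in> K" "u' \<in> K"
    using e(2) e'(2) branch_self[of u p] branch_self[of u' p] by (simp_all add: departs_along_Some subset_iff)
  then have "u \<le> u' \<or> u' \<le> u" using chain by blast
  then show ?thesis
    using main[of u u' y y'] main[of u' u y' y] e e' unfolding \<open>e = _\<close> \<open>e' = _\<close> by metis
qed

lemma ex_maximal_chain_departing:
  assumes "e \<in> nontree_edges"
  shows "\<exists>K \<in> maximal_chains. departs_along K e"
proof -
  obtain u y where [simp]: "e = (Some u, y)"
    using nontree_edge_source[OF assms] by blast
  have "is_chain (branch p u \<union> set_option y)"
  proof (cases y)
    case None
    then show ?thesis using branch_chain[of u] by simp
  next
    case (Some v)
    then have "z \<le> v" if "z \<in> branch p u" for z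
      using branch_le[OF that] assms by auto
    then show ?thesis using Some branch_chain[of u] by auto
  qed
  then obtain K where "K \<in> maximal_chains" "branch p u \<union> set_option y \<subseteq> K"
    by (rule chain_extends_to_maximal)
  then show ?thesis by (auto simp: departs_along_Some)
qed

text \<open>
  If \<open>a\<close> and \<open>b\<close> are incomparable below \<open>c\<close>, one of them misses the branch of \<open>c\<close>, so some
  nontree edge ends below \<open>c\<close>; chains departing along it may afterwards pass through \<open>c\<close> and
  through either of two incomparable elements above \<open>c\<close>.
\<close>

lemma two_maximal_chains_departing:
  fixes a b c q r :: 'a
  assumes "a < c" "b < c" "c < q" "c < r"
    and ab: "\<not> a \<le> b" "\<not> b \<le> a" and qr: "\<not> q \<le> r" "\<not> r \<le> q"
  shows "\<exists>e K L. e \<in> nontree_edges \<and> K \<in> maximal_chains \<and> L \<in> maximal_chains \<and> K \<noteq> L \<and>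
           departs_along K e \<and> departs_along L e"
proof -
  have "a \<notin> branch p c \<or> b \<notin> branch p c" using branch_chain[of c] ab by blast
  then obtain u v where e: "(Some u, Some v) \<in> nontree_edges" "v \<le> c"
    using nontree_edge_below[of a c] nontree_edge_below[of b c] assms(1,2)
    by (blast dest: order.strict_implies_order)
  then have uv: "u < v" by (simp add: nontree_edge_iff del: DiffI)
  have ex: "\<exists>K \<in> maximal_chains. departs_along K (Some u, Some v) \<and> x \<in> K" if "c < x" for x
  proof -
    have "z \<le> v" "z \<le> x" if "z \<in> branch p u" for z
      using branch_le[OF that] uv e(2) \<open>c < x\<close> by auto
    then have "is_chain (branch p u \<union> {v, x})"
      using branch_chain[of u] e(2) that by auto
    then obtain K where "K \<in> maximal_chains" "branch p u \<union> {v, x} \<subseteq> K"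
      by (rule chain_extends_to_maximal)
    then show ?thesis by (auto simp: departs_along_Some)
  qed
  obtain K L where KL: "K \<in> maximal_chains" "departs_along K (Some u, Some v)" "q \<in> K"
    "L \<in> maximal_chains" "departs_along L (Some u, Some v)" "r \<in> L"
    using ex[OF assms(3)] ex[OF assms(4)] by blast
  moreover have "K \<noteq> L" using KL qr by (auto simp: maximal_chain_iff)
  ultimately show ?thesis using e(1) by blast
qed

end

text \<open>
  Each nontree edge is the place where some maximal chain departs from the tree, and a chain
  departs only once; hence maximal chains are at least as many as nontree edges.  The poset \<open>X\<close>
  forces two maximal chains to depart along a common edge, which makes the count strict.
\<close>

lemma card_hat_edges_less:
  fixes a b c q r :: "'a::{finite,order}"
  assumes "a < c" "b < c" "c < q" "c < r"
    and "\<not> a \<le> b" "\<not> b \<le> a" "\<not> q \<le> r" "\<not> r \<le> q"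
  shows "card (hat_edges :: ('a option \<times> 'a option) set) < CARD('a) + card (maximal_chains :: 'a set set)"
proof -
  obtain p :: "'a \<Rightarrow> 'a option" where "\<And>v. hat_edge (p v) (Some v)"
    using ex_hat_edge_below by metis
  then interpret spanning_tree p by unfold_locales
  obtain f where f: "\<And>e. e \<in> nontree_edges \<Longrightarrow> f e \<in> maximal_chains \<and> departs_along (f e) e"
    using ex_maximal_chain_departing by (meson bchoice[of nontree_edges])
  obtain e K L where e: "e \<in> nontree_edges" "K \<in> maximal_chains" "L \<in> maximal_chains" "K \<noteq> L"
    "departs_along K e" "departs_along L e"
    using two_maximal_chains_departing[OF assms] by blast
  have unique: "g = h" if "g \<in> nontree_edges" "h \<in> nontree_edges" "M \<in> maximal_chains"
    "departs_along M g" "departs_along M h" for g h M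
    using departure_unique[of M g h] that by (simp add: maximal_chain_iff)
  have "inj_on f nontree_edges"
  proof (rule inj_onI)
    fix g h assume "g \<in> nontree_edges" "h \<in> nontree_edges" "f g = f h"
    then show "g = h" using f[of g] f[of h] unique[of g h "f g"] by simp
  qed
  moreover obtain M where M: "M \<in> maximal_chains" "M \<noteq> f e" "departs_along M e"
    using e by (cases "K = f e") auto
  have "M \<notin> f ` nontree_edges"
  proof
    assume "M \<in> f ` nontree_edges"
    then obtain g where "g \<in> nontree_edges" "M = f g" by blast
    then show False using f[of g] unique[of g e M] e(1) M by auto
  qed
  then have "f ` nontree_edges \<subset> maximal_chains" using f M(1) by blast
  then have "card (f ` nontree_edges) < card (maximal_chains :: 'a set set)"
    by (intro psubset_card_mono) auto
  ultimately show ?thesis by (simp only: card_hat_edges card_image)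
qed

section \<open>Facet inequalities of the order polytope\<close>

abbreviation hat_coord :: "real \<Rightarrow> real ^ 'n \<Rightarrow> 'n option \<Rightarrow> real" where
  "hat_coord c a x \<equiv> (case x of None \<Rightarrow> c | Some i \<Rightarrow> a $ i)"

lemma order_polytope_iff_hat_edges:
  fixes a :: "real ^ 'n::{finite,order}"
  shows "a \<in> order_polytope \<longleftrightarrow> (\<forall>x y. hat_edge x y \<longrightarrow> hat_coord 0 a y \<le> hat_coord 1 a x)"
proof
  assume a: "a \<in> order_polytope"
  show "\<forall>x y. hat_edge x y \<longrightarrow> hat_coord 0 a y \<le> hat_coord 1 a x"
  proof (intro allI impI)
    fix x y :: "'n option" assume "hat_edge x y"
    then show "hat_coord 0 a y \<le> hat_coord 1 a x"
      using a by (cases x; cases y) (auto simp: order_polytope_def)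
  qed
next
  assume R: "\<forall>x y. hat_edge x y \<longrightarrow> hat_coord 0 a y \<le> hat_coord 1 a x"
  have mono: "i \<le> j \<longrightarrow> a $ j \<le> a $ i" for i j
  proof (induction j rule: finite_order_less_induct)
    case (less j)
    show ?case
    proof (cases "i < j")
      case True
      then obtain k where k: "i \<le> k" "hat_edge (Some k) (Some j)" by (rule cover_below)
      then have "a $ j \<le> a $ k" using R[rule_format, of "Some k" "Some j"] by simp
      then show ?thesis using less[of k] k by auto
    qed (auto simp: le_less)
  qed
  have low: "0 \<le> a $ i" for i
  proof (induction i rule: finite_order_greater_induct)
    case (greater i)
    obtain y where "hat_edge (Some i) y" using ex_hat_edge_above by blast
    then show ?case using R[rule_format, of "Some i" y] greater by (cases y) fastforce+
  qed
  have high: "a $ i \<le> 1" for i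
  proof (induction i rule: finite_order_less_induct)
    case (less i)
    obtain x where "hat_edge x (Some i)" using ex_hat_edge_below by blast
    then show ?case using R[rule_format, of x "Some i"] less by (cases x) fastforce+
  qed
  show "a \<in> order_polytope" using mono low high by (simp add: order_polytope_def)
qed

section \<open>An affine invariant that bounds the number of facets\<close>

text \<open>
  The complement of the order polytope is a union of open half-spaces, one per edge.  Two points
  in the same half-space have their midpoint in it, so a family of outer points all of whose
  midpoints are inner points has at most one member in each half-space.
\<close>

lemma card_outer_family_order_polytope:
  fixes z :: "'h \<Rightarrow> real ^ 'n::{finite,order}"
  assumes outer: "\<And>h. h \<in> I \<Longrightarrow> z h \<notin> order_polytope"
    and inner: "\<And>g h. g \<in> I \<Longrightarrow> h \<in> I \<Longrightarrow> g \<noteq> h \<Longrightarrow> midpoint (z g) (z h) \<in> order_polytope"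
  shows "card I \<le> card (hat_edges :: ('n option \<times> 'n option) set)"
proof -
  let ?bad = "\<lambda>a e. hat_edge (fst e) (snd e) \<and> hat_coord 1 a (fst e) < hat_coord 0 a (snd e)"
  have "\<exists>e. ?bad (z h) e" if "h \<in> I" for h
    using outer[OF that] unfolding order_polytope_iff_hat_edges by (auto simp: not_le)
  then obtain f where f: "\<And>h. h \<in> I \<Longrightarrow> ?bad (z h) (f h)" by metis
  have "inj_on f I"
  proof (rule inj_onI, rule ccontr)
    fix g h assume gh: "g \<in> I" "h \<in> I" "f g = f h" "g \<noteq> h"
    obtain x y where xy: "f h = (x, y)" by (cases "f h")
    have bad: "?bad (z g) (x, y)" "?bad (z h) (x, y)" using f gh xy by metis+
    have mid: "hat_coord c (midpoint a b) w = (hat_coord c a w + hat_coord c b w) / 2"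
      for c and a b :: "real ^ 'n::{finite,order}" and w by (cases w) (auto simp: midpoint_def)
    have "hat_coord 0 (midpoint (z g) (z h)) y \<le> hat_coord 1 (midpoint (z g) (z h)) x"
      using inner[OF gh(1,2,4)] bad by (simp add: order_polytope_iff_hat_edges)
    then show False using bad unfolding mid by simp
  qed
  moreover have "f ` I \<subseteq> hat_edges" using f by (auto simp: case_prod_unfold)
  ultimately show ?thesis by (metis card_image card_mono finite)
qed

text \<open>
  Dually, the chain polytope has such a family with one member beyond each of its inequalities:
  a point that violates one inequality and satisfies every other one of the same kind with at least
  as much slack.  With \<open>t = 1 / (2 * d\<^sup>2)\<close> and \<open>e = 1 / (4 * d)\<close>, sign inequalities are violated
  by \<open>t\<close> and chain inequalities by \<open>e\<close>; the unit \<open>t\<close> is so small that \<open>d\<close> coordinates of this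
  size add up to only \<open>2 * e\<close>, while omitting a single element of \<open>K\<close> lowers the sum over \<open>K\<close>
  by at least \<open>4 * e\<close>.
\<close>

definition outer_point :: "'n + 'n set \<Rightarrow> real ^ 'n::{finite,order}" where
  "outer_point h = (let d = real CARD('n); t = 1 / (2 * d\<^sup>2) in
     case h of
       Inl i \<Rightarrow> (\<chi> j. if j = i then - t else t)
     | Inr K \<Rightarrow> (\<chi> j. if j \<in> K then (1 + 1 / (4 * d)) / real (card K) else t))"

lemma maximal_chain_nonempty:
  fixes K :: "'a::order set"
  assumes "K \<in> maximal_chains"
  shows "K \<noteq> {}"
proof
  assume "K = {}"
  moreover have "is_chain {x} \<and> K \<subseteq> {x} \<longrightarrow> {x} = K" for x
    using assms unfolding mem_Collect_eq maximal_chain_iff by blast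
  ultimately show False by simp
qed

lemma chain_polytope_outer_family:
  fixes I :: "('n::{finite,order} + 'n set) set"
  defines "I \<equiv> range Inl \<union> Inr ` maximal_chains"
  shows "h \<in> I \<Longrightarrow> outer_point h \<notin> chain_polytope"
    and "g \<in> I \<Longrightarrow> h \<in> I \<Longrightarrow> g \<noteq> h \<Longrightarrow> midpoint (outer_point g) (outer_point h) \<in> chain_polytope"
proof -
  define d where "d = real CARD('n)"
  define t where "t = 1 / (2 * d\<^sup>2)"
  define e where "e = 1 / (4 * d)"
  have d: "1 \<le> d" by (simp add: d_def Suc_le_eq)
  have t: "0 < t" and e: "0 < e" "e \<le> 1/4" and dt: "d * t = 2 * e"
    using d by (auto simp: t_def e_def field_simps power2_eq_square)
  have at_Inl: "outer_point (Inl i) $ j = (if j = i then - t else t)" for i j :: 'n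
    by (simp add: outer_point_def t_def d_def Let_def)
  have at_Inr: "outer_point (Inr K) $ j = (if j \<in> K then (1 + e) / real (card K) else t)" for K and j :: 'n
    by (simp add: outer_point_def t_def d_def e_def Let_def)
  have card_le: "real (card K) \<le> d" for K :: "'n set" by (simp add: d_def card_mono)
  have pos: "t \<le> outer_point (Inr K) $ j" if "K \<in> maximal_chains" for K and j :: 'n
  proof -
    have "0 < real (card K)" using maximal_chain_nonempty[OF that] by (simp add: card_gt_0_iff)
    then have "1 / d \<le> (1 + e) / real (card K)"
      using card_le[of K] e by (intro frac_le) auto
    moreover have "t \<le> 1 / d" using d by (simp add: t_def field_simps power2_eq_square)
    ultimately show ?thesis by (simp add: at_Inr)
  qed
  have sum_Inl: "sum (($) (outer_point (Inl i))) L \<le> 2 * e" for i and L :: "'n set"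
  proof -
    have "sum (($) (outer_point (Inl i))) L \<le> real (card L) * t"
      using t by (intro sum_bounded_above) (simp add: at_Inl)
    also have "\<dots> \<le> d * t" using card_le t by (intro mult_right_mono) auto
    finally show ?thesis using dt by simp
  qed
  have sum_self: "sum (($) (outer_point (Inr K))) K = 1 + e" if "K \<in> maximal_chains" for K :: "'n set"
    using maximal_chain_nonempty[OF that] by (simp add: at_Inr)
  have sum_other: "sum (($) (outer_point (Inr K))) L \<le> 1 - e"
    if K: "K \<in> maximal_chains" and L: "L \<in> maximal_chains" and "L \<noteq> K" for K L :: "'n set"
  proof -
    have k: "1 \<le> real (card K)" using maximal_chain_nonempty[OF K] by (simp add: Suc_le_eq card_gt_0_iff)
    have "\<not> K \<subseteq> L" using K L \<open>L \<noteq> K\<close> by (auto simp: maximal_chain_iff)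
    then have "card (L \<inter> K) < card K" by (intro psubset_card_mono) auto
    then have "real (card (L \<inter> K)) \<le> real (card K) - 1" by linarith
    then have "real (card (L \<inter> K)) * ((1 + e) / real (card K)) \<le> (real (card K) - 1) * ((1 + e) / real (card K))"
      using e k by (intro mult_right_mono) auto
    also have "\<dots> = (1 + e) - (1 + e) / real (card K)"
    proof -
      have "(k - 1) * ((1 + e) / k) = (1 + e) - (1 + e) / k" if "1 \<le> k" for k :: real
        using that by (simp add: field_simps)
      then show ?thesis using k by blast
    qed
    \<comment> \<open>A chain has at most \<open>d\<close> elements, so each of them carries at least \<open>1 / d = 4 * e\<close>.\<close>
    also have "\<dots> \<le> (1 + e) - 4 * e"
    proof -
      have "(1 + e) / d \<le> (1 + e) / real (card K)" using card_le[of K] e k by (intro divide_left_mono) auto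
      moreover have "4 * e \<le> (1 + e) / d"
        using d e divide_right_mono[of 1 "1 + e" d] by (simp add: e_def)
      ultimately show ?thesis by linarith
    qed
    finally have A: "real (card (L \<inter> K)) * ((1 + e) / real (card K)) \<le> 1 - 3 * e" by simp
    have "real (card (L - K)) * t \<le> d * t" using card_le t by (intro mult_right_mono) auto
    then have B: "real (card (L - K)) * t \<le> 2 * e" using dt by simp
    have "sum (($) (outer_point (Inr K))) L = real (card (L \<inter> K)) * ((1 + e) / real (card K)) + real (card (L - K)) * t"
      by (subst sum.Int_Diff[of L _ K]) (auto simp: at_Inr)
    then show ?thesis using A B by linarith
  qed
  have sum_le: "sum (($) (outer_point (Inr K))) L \<le> 1 + e"
    if "K \<in> maximal_chains" "L \<in> maximal_chains" for K L :: "'n set"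
    using sum_self[of K] sum_other[of K L] that e by (cases "L = K") auto
  have chain_polytope_iff: "a \<in> chain_polytope \<longleftrightarrow> (\<forall>i. 0 \<le> a $ i) \<and> (\<forall>L\<in>maximal_chains. sum (($) a) L \<le> 1)"
    for a :: "real ^ 'n::{finite,order}" by (auto simp: chain_polytope_def)
  show "outer_point h \<notin> chain_polytope" if h: "h \<in> I"
  proof (cases h)
    case (Inl i)
    then have "outer_point h $ i < 0" using at_Inl t by simp
    then show ?thesis unfolding chain_polytope_iff by (meson not_le)
  next
    case (Inr K)
    then have K: "K \<in> maximal_chains" using h by (auto simp: I_def)
    have "1 < sum (($) (outer_point h)) K" using sum_self[OF K] e unfolding Inr by simp
    then show ?thesis using K unfolding chain_polytope_iff by (meson not_le)
  qed
  show "midpoint (outer_point g) (outer_point h) \<in> chain_polytope"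
    if g: "g \<in> I" and h: "h \<in> I" and "g \<noteq> h"
  proof -
    have "0 \<le> outer_point g $ j + outer_point h $ j" for j
    proof -
      have "- t \<le> outer_point f $ j" if "f \<in> I" for f
        using that pos[of _ j] t by (force simp: I_def at_Inl)
      moreover have "t \<le> outer_point f $ j" if "f \<in> I" "f \<noteq> Inl j" for f
        using that pos[of _ j] t by (auto simp: I_def at_Inl split: if_splits)
      ultimately show ?thesis using g h \<open>g \<noteq> h\<close>
        by (cases "g = Inl j") force+
    qed
    moreover have "sum (($) (outer_point g)) L + sum (($) (outer_point h)) L \<le> 2"
      if L: "L \<in> maximal_chains" for L
    proof -
      have "sum (($) (outer_point f)) L \<le> 1 + e" if "f \<in> I" for f
      proof (cases f)
        case (Inl i)
        then show ?thesis using sum_Inl[of i L] e by simp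
      next
        case (Inr K)
        then show ?thesis using that sum_le[OF _ L, of K] by (auto simp: I_def)
      qed
      moreover have "sum (($) (outer_point f)) L \<le> 1 - e" if "f \<in> I" "f \<noteq> Inr L" for f
      proof (cases f)
        case (Inl i)
        then show ?thesis using sum_Inl[of i L] e by simp
      next
        case (Inr K)
        then show ?thesis using that sum_other[OF _ L, of K] by (auto simp: I_def)
      qed
      ultimately show ?thesis using g h \<open>g \<noteq> h\<close>
        by (cases "g = Inr L") force+
    qed
    ultimately show ?thesis
      unfolding chain_polytope_iff
      by (simp add: midpoint_def sum.distrib flip: sum_distrib_left sum_divide_distrib)
  qed
qed

lemma det_map_matrix_of_int: "det (map_matrix real_of_int U) = real_of_int (det U)"
  by (simp add: det_def)

text \<open>A unimodular map is an affine bijection of the whole space, hence transports such families.\<close>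

lemma facets_le_if_unimodularly_equivalent:
  assumes "unimodularly_equivalent (order_polytope :: (real ^ 'n::{finite,order}) set) chain_polytope"
  shows "CARD('n) + card (maximal_chains :: 'n set set)
           \<le> card (hat_edges :: ('n option \<times> 'n option) set)"
proof -
  obtain U :: "int ^ 'n::{finite,order} ^ 'n::{finite,order}" and w :: "int ^ 'n::{finite,order}" where U: "det U = 1 \<or> det U = - 1"
    and image: "chain_polytope
      = (\<lambda>v. v v* map_matrix real_of_int U + (\<chi> i. real_of_int (w $ i))) ` order_polytope"
    using assms unfolding unimodularly_equivalent_def by blast
  define A where "A = map_matrix real_of_int U"
  define c where "c = (\<chi> i. real_of_int (w $ i))"
  define F where "F v = v v* A + c" for v
  have "invertible A" using U by (auto simp: A_def invertible_det_nz det_map_matrix_of_int)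
  then obtain B where B: "A ** B = mat 1" "B ** A = mat 1" unfolding invertible_def by blast
  define G where "G v = (v - c) v* B" for v
  have FG: "F (G v) = v" "G (F v) = v" for v
    by (simp_all add: F_def G_def vector_matrix_mul_assoc B)
  have F_image: "chain_polytope = F ` order_polytope"
    unfolding image F_def A_def c_def ..
  have F_iff: "F v \<in> chain_polytope \<longleftrightarrow> v \<in> order_polytope" for v
  proof
    assume "F v \<in> chain_polytope"
    then obtain u where "u \<in> order_polytope" "F v = F u" unfolding F_image by blast
    then show "v \<in> order_polytope" using FG(2)[of u] FG(2)[of v] by simp
  qed (simp add: F_image)
  have F_mid: "F (midpoint u v) = midpoint (F u) (F v)" for u v
    by (simp add: F_def midpoint_def vector_matrix_left_distrib scaleR_vector_matrix_assoc
        vec_eq_iff field_simps)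
  let ?I = "range Inl \<union> Inr ` maximal_chains :: ('n + 'n set) set"
  have "card ?I \<le> card (hat_edges :: ('n option \<times> 'n option) set)"
  proof (rule card_outer_family_order_polytope[where z = "\<lambda>h. G (outer_point h)"])
    fix g h assume gh: "g \<in> ?I" "h \<in> ?I"
    show "G (outer_point h) \<notin> order_polytope"
      using chain_polytope_outer_family(1)[OF gh(2)] by (simp add: FG flip: F_iff)
    show "midpoint (G (outer_point g)) (G (outer_point h)) \<in> order_polytope" if "g \<noteq> h"
      using chain_polytope_outer_family(2)[OF gh that] by (simp add: FG F_mid flip: F_iff)
  qed
  also have "card ?I = CARD('n) + card (maximal_chains :: 'n set set)"
    by (subst card_Un_disjoint) (auto simp: card_image)
  finally show ?thesis .
qed

section \<open>The unimodular map for a poset without \<open>X\<close>\<close>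

abbreviation below_hat :: "'a::order option \<Rightarrow> 'a set" where
  "below_hat x \<equiv> (case x of None \<Rightarrow> {} | Some i \<Rightarrow> {..i})"

abbreviation above_hat :: "'a::order option \<Rightarrow> 'a set" where
  "above_hat y \<equiv> (case y of None \<Rightarrow> {} | Some i \<Rightarrow> {i..})"

lemma below_eq_iff: "below_hat x = below_hat y \<longleftrightarrow> x = y"
  by (auto split: option.splits)

lemma above_eq_iff: "above_hat x = above_hat y \<longleftrightarrow> x = y"
  by (auto split: option.splits)

lemma below_edge_source:
  fixes i :: "'a::{finite,order}"
  assumes "hat_edge x (Some i)" "is_chain {..<i}"
  shows "below_hat x = {..<i}"
proof (cases x)
  case (Some p)
  then have "p < i" "\<And>k. \<not> (p < k \<and> k < i)" using assms by auto
  moreover have "k \<le> p" if "k < i" for k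
    using assms(2) that calculation by (metis lessThan_iff le_less)
  ultimately show ?thesis using Some by auto
qed (use assms in auto)

lemma above_edge_target:
  fixes i :: "'a::{finite,order}"
  assumes "hat_edge (Some i) y" "is_chain {i<..}"
  shows "above_hat y = {i<..}"
proof (cases y)
  case (Some q)
  then have "i < q" "\<And>k. \<not> (i < k \<and> k < q)" using assms by auto
  moreover have "q \<le> k" if "i < k" for k
    using assms(2) that calculation by (metis greaterThan_iff le_less)
  ultimately show ?thesis using Some by auto
qed (use assms in auto)

lemma is_chain_atMost:
  assumes "is_chain {..<i}" shows "is_chain {..i}"
proof (intro ballI)
  fix x y assume "x \<in> {..i}" "y \<in> {..i}"
  then show "x \<le> y \<or> y \<le> x" using assms by (cases "x = i"; cases "y = i") (auto simp: less_le)
qed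

lemma is_chain_atLeast:
  assumes "is_chain {i<..}" shows "is_chain {i..}"
proof (intro ballI)
  fix x y assume "x \<in> {i..}" "y \<in> {i..}"
  then show "x \<le> y \<or> y \<le> x" using assms by (cases "x = i"; cases "y = i") (auto simp: less_le)
qed

lemma sum_of_bool_Some:
  fixes f :: "'a::finite \<Rightarrow> 'b::semiring_1"
  shows "(\<Sum>j\<in>UNIV. f j * of_bool (x = Some j)) = (case x of None \<Rightarrow> 0 | Some p \<Rightarrow> f p)"
  by (cases x) (auto simp: of_bool_def if_distrib cong: if_cong)

lemma sum_of_bool_eq:
  fixes f :: "'a::finite \<Rightarrow> 'b::semiring_1"
  shows "(\<Sum>j\<in>UNIV. f j * of_bool (j = i)) = f i"
  by (auto simp: of_bool_def if_distrib cong: if_cong)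

text \<open>
  On \<open>D\<close> the Hasse diagram is a forest growing upwards from the bottom with parent function \<open>pr\<close>;
  on the complement of \<open>D\<close> it is a forest growing downwards from the top with parent function \<open>sc\<close>.
\<close>

locale forest_partition =
  fixes D :: "'n::{finite,order} set" and pr sc :: "'n \<Rightarrow> 'n option"
  assumes pr_edge: "hat_edge (pr i) (Some i)"
    and sc_edge: "hat_edge (Some i) (sc i)"
    and down: "i \<in> D \<Longrightarrow> j \<le> i \<Longrightarrow> j \<in> D"
    and chain_down: "i \<in> D \<Longrightarrow> is_chain {..<i}"
    and chain_up: "i \<notin> D \<Longrightarrow> is_chain {i<..}"
begin

lemma atMost_D: "i \<in> D \<Longrightarrow> {..i} = insert i (below_hat (pr i))"
  unfolding below_edge_source[OF pr_edge chain_down] by (auto simp: le_less)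

lemma atLeast_not_D: "i \<notin> D \<Longrightarrow> {i..} = insert i (above_hat (sc i))"
  unfolding above_edge_target[OF sc_edge chain_up] by (auto simp: le_less)

lemma pr_in_D: "i \<in> D \<Longrightarrow> pr i = Some p \<Longrightarrow> p \<in> D"
  using pr_edge[of i] down[of i p] by (simp add: less_imp_le)

lemma sc_not_in_D: "i \<notin> D \<Longrightarrow> sc i = Some q \<Longrightarrow> q \<notin> D"
  using sc_edge[of i] down[of q i] by (auto simp: less_imp_le)

lemma not_in_below: "i \<notin> below_hat (pr i)"
  using pr_edge[of i] by (auto split: option.splits)

lemma not_in_above: "i \<notin> above_hat (sc i)"
  using sc_edge[of i] by (auto split: option.splits)

text \<open>
  Subtracting an extreme coordinate among the neighbours on one side gives a piecewise linear
  transfer map between the two polytopes.  Here each element is compared with the side on which it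
  has a single neighbour, so there is no extremum to take and the map is affine.
\<close>

definition difference_map :: "real ^ 'n::{finite,order} \<Rightarrow> real ^ 'n::{finite,order}" where
  "difference_map a =
     (\<chi> i. if i \<in> D then hat_coord 1 a (pr i) - a $ i else a $ i - hat_coord 0 a (sc i))"

text \<open>Sums along a branch telescope; this is what turns chain sums into order inequalities.\<close>

lemma sum_difference_atMost: "i \<in> D \<longrightarrow> sum (($) (difference_map a)) {..i} = 1 - a $ i"
proof (induction i rule: finite_order_less_induct)
  case (less i)
  show ?case
  proof
    assume i: "i \<in> D"
    have "sum (($) (difference_map a)) (below_hat (pr i)) = 1 - hat_coord 1 a (pr i)"
      using less pr_edge[of i] pr_in_D[OF i] by (cases "pr i") auto
    then show "sum (($) (difference_map a)) {..i} = 1 - a $ i"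
      using i by (simp add: atMost_D not_in_below difference_map_def)
  qed
qed

lemma sum_difference_atLeast: "i \<notin> D \<longrightarrow> sum (($) (difference_map a)) {i..} = a $ i"
proof (induction i rule: finite_order_greater_induct)
  case (greater i)
  show ?case
  proof
    assume i: "i \<notin> D"
    have "sum (($) (difference_map a)) (above_hat (sc i)) = hat_coord 0 a (sc i)"
      using greater sc_edge[of i] sc_not_in_D[OF i] by (cases "sc i") auto
    then show "sum (($) (difference_map a)) {i..} = a $ i"
      using i by (simp add: atLeast_not_D not_in_above difference_map_def)
  qed
qed

lemma sum_difference_below:
  "set_option x \<subseteq> D \<Longrightarrow> sum (($) (difference_map a)) (below_hat x) = 1 - hat_coord 1 a x"
  using sum_difference_atMost by (cases x) auto

lemma sum_difference_above:
  "set_option y \<inter> D = {} \<Longrightarrow> sum (($) (difference_map a)) (above_hat y) = hat_coord 0 a y"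
  using sum_difference_atLeast by (cases y) auto

text \<open>
  A chain is contained in the down-set of its last element in \<open>D\<close> and the up-set of its first
  element outside \<open>D\<close>.
\<close>

lemma chain_split:
  assumes "is_chain K"
  obtains x y where "set_option x \<subseteq> K \<inter> D" "K \<inter> D \<subseteq> below_hat x"
    "set_option y \<subseteq> K - D" "K - D \<subseteq> above_hat y"
proof -
  have "\<exists>x. set_option x \<subseteq> K \<inter> D \<and> K \<inter> D \<subseteq> below_hat x"
  proof (cases "K \<inter> D = {}")
    case False
    then obtain m where m: "m \<in> K \<inter> D" "\<And>k. k \<in> K \<inter> D \<Longrightarrow> m \<le> k \<Longrightarrow> m = k"
      using finite_has_maximal[of "K \<inter> D"] by auto
    then have "K \<inter> D \<subseteq> {..m}" using assms by blast
    then show ?thesis using m by (intro exI[of _ "Some m"]) auto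
  qed (auto intro: exI[of _ None])
  moreover have "\<exists>y. set_option y \<subseteq> K - D \<and> K - D \<subseteq> above_hat y"
  proof (cases "K - D = {}")
    case False
    then obtain m where m: "m \<in> K - D" "\<And>k. k \<in> K - D \<Longrightarrow> k \<le> m \<Longrightarrow> m = k"
      using finite_has_minimal[of "K - D"] by auto
    then have "K - D \<subseteq> {m..}" using assms by blast
    then show ?thesis using m by (intro exI[of _ "Some m"]) auto
  qed (auto intro: exI[of _ None])
  ultimately show thesis using that by blast
qed

lemma difference_map_in_chain_polytope_iff:
  "difference_map a \<in> chain_polytope \<longleftrightarrow> a \<in> order_polytope"
proof
  let ?b = "difference_map a"
  assume a: "a \<in> order_polytope"
  then have edge: "hat_edge x y \<Longrightarrow> hat_coord 0 a y \<le> hat_coord 1 a x" for x y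
    by (simp add: order_polytope_iff_hat_edges)
  have nonneg: "0 \<le> ?b $ i" for i
    using edge[OF pr_edge[of i]] edge[OF sc_edge[of i]] by (simp add: difference_map_def)
  have "sum (($) ?b) K \<le> 1" if K: "is_chain K" for K
  proof -
    obtain x y where x: "set_option x \<subseteq> K \<inter> D" "K \<inter> D \<subseteq> below_hat x"
      and y: "set_option y \<subseteq> K - D" "K - D \<subseteq> above_hat y"
      using K by (rule chain_split)
    have "sum (($) ?b) K = sum (($) ?b) (K \<inter> D) + sum (($) ?b) (K - D)"
      by (rule sum.Int_Diff) simp
    also have "\<dots> \<le> sum (($) ?b) (below_hat x) + sum (($) ?b) (above_hat y)"
      using x y nonneg by (intro add_mono sum_mono2) auto
    also have "\<dots> = 1 - hat_coord 1 a x + hat_coord 0 a y"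
    proof -
      have "set_option x \<subseteq> D" "set_option y \<inter> D = {}" using x y by auto
      then show ?thesis by (simp only: sum_difference_below sum_difference_above)
    qed
    also have "\<dots> \<le> 1"
    proof (cases "x = None \<or> y = None")
      case True
      then show ?thesis using a by (cases x; cases y) (auto simp: order_polytope_def)
    next
      case False
      then obtain i j where ij: "x = Some i" "y = Some j" by auto
      then have "i \<le> j" using x y K down[of i j] by auto
      then show ?thesis using a ij by (simp add: order_polytope_def)
    qed
    finally show ?thesis .
  qed
  then show "?b \<in> chain_polytope"
    using nonneg by (simp add: chain_polytope_def maximal_chain_iff)
next
  let ?b = "difference_map a"
  assume b: "?b \<in> chain_polytope"
  then have nonneg: "0 \<le> ?b $ i" for i by (simp add: chain_polytope_def)
  have chain_sum: "sum (($) ?b) C \<le> 1" if C: "is_chain C" for C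
  proof -
    obtain K where K: "K \<in> maximal_chains" "C \<subseteq> K" using C by (rule chain_extends_to_maximal)
    then have "sum (($) ?b) C \<le> sum (($) ?b) K" using nonneg by (intro sum_mono2) auto
    also have "\<dots> \<le> 1" using b K by (simp add: chain_polytope_def)
    finally show ?thesis .
  qed
  have "hat_coord 0 a y \<le> hat_coord 1 a x" if edge: "hat_edge x y" for x y
  proof -
    consider j where "y = Some j" "j \<in> D" | i where "x = Some i" "i \<notin> D"
      | "set_option x \<subseteq> D" "set_option y \<inter> D = {}"
      by (cases x; cases y) auto
    then show ?thesis
    proof cases
      case 1
      then have "x = pr j"
        using below_edge_source[OF _ chain_down[of j]] edge pr_edge below_eq_iff by metis
      then show ?thesis using 1 nonneg[of j] by (simp add: difference_map_def)
    next
      case 2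
      then have "y = sc i"
        using above_edge_target[OF _ chain_up[of i]] edge sc_edge above_eq_iff by metis
      then show ?thesis using 2 nonneg[of i] by (simp add: difference_map_def)
    next
      case 3
      \<comment> \<open>The edge leads from \<open>D\<close> or the bottom to the complement of \<open>D\<close> or the top, and its
        inequality is the chain inequality for a path through it.\<close>
      have "is_chain (below_hat x)"
      proof (cases x)
        case (Some i)
        then have "is_chain {..i}" using 3 by (intro is_chain_atMost chain_down) simp
        then show ?thesis using Some by simp
      qed simp
      moreover have "is_chain (above_hat y)"
      proof (cases y)
        case (Some j)
        then have "is_chain {j..}" using 3 by (intro is_chain_atLeast chain_up) simp
        then show ?thesis using Some by simp
      qed simp
      moreover have "i \<le> j" if ij: "i \<in> below_hat x" "j \<in> above_hat y" for i j
      proof -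
        obtain p q where "x = Some p" "y = Some q" "i \<le> p" "q \<le> j"
          using ij by (cases x; cases y) auto
        then show ?thesis using edge by (auto intro: order_trans less_imp_le)
      qed
      ultimately have "is_chain (below_hat x \<union> above_hat y)" by blast
      then have "sum (($) ?b) (below_hat x \<union> above_hat y) \<le> 1" by (rule chain_sum)
      moreover have "below_hat x \<inter> above_hat y = {}"
        using 3 down by (cases x; cases y) auto
      ultimately show ?thesis
        using 3 by (simp add: sum.union_disjoint sum_difference_below sum_difference_above)
    qed
  qed
  then show "a \<in> order_polytope" by (simp add: order_polytope_iff_hat_edges)
qed

text \<open>
  The linear part of the difference map and, read off from the telescoping sums, its inverse.
  Vectors are rows, so the column index \<open>i\<close> belongs to the coordinate of the image.
\<close>

definition difference_matrix :: "int ^ 'n::{finite,order} ^ 'n::{finite,order}" where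
  "difference_matrix = (\<chi> j i. if i \<in> D then of_bool (pr i = Some j) - of_bool (j = i)
                                 else of_bool (j = i) - of_bool (sc i = Some j))"

definition sum_matrix :: "int ^ 'n::{finite,order} ^ 'n::{finite,order}" where
  "sum_matrix = (\<chi> k j. if j \<in> D then - of_bool (k \<le> j) else of_bool (j \<le> k))"

lemma difference_map_affine:
  "difference_map a = a v* map_matrix real_of_int difference_matrix
     + (\<chi> i. real_of_int ((\<chi> i. of_bool (i \<in> D \<and> pr i = None)) $ i))"
proof -
  have "difference_map a $ i = (\<Sum>j\<in>UNIV. a $ j * real_of_int (difference_matrix $ j $ i))
      + of_bool (i \<in> D \<and> pr i = None)" for i
    by (simp add: difference_map_def difference_matrix_def right_diff_distrib sum_subtractf
        sum_of_bool_Some sum_of_bool_eq split: option.split)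
  then show ?thesis by (simp add: vec_eq_iff vector_matrix_mult_def)
qed

lemma sum_matrix_inverse: "sum_matrix ** difference_matrix = mat 1"
proof -
  have "(\<Sum>j\<in>UNIV. sum_matrix $ k $ j * difference_matrix $ j $ i) = of_bool (k = i)" for k i
  proof (cases "i \<in> D")
    case True
    have "(\<Sum>j\<in>UNIV. sum_matrix $ k $ j * difference_matrix $ j $ i)
        = (case pr i of None \<Rightarrow> 0 | Some p \<Rightarrow> sum_matrix $ k $ p) - sum_matrix $ k $ i"
      using True by (simp add: difference_matrix_def right_diff_distrib sum_subtractf
          sum_of_bool_Some sum_of_bool_eq)
    also have "\<dots> = of_bool (k \<in> {..i}) - of_bool (k \<in> below_hat (pr i))"
      using True pr_edge[of i] pr_in_D[OF True] by (auto simp: sum_matrix_def split: option.split)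
    also have "\<dots> = of_bool (k = i)"
      using not_in_below[of i] unfolding atMost_D[OF True] by auto
    finally show ?thesis .
  next
    case False
    have "(\<Sum>j\<in>UNIV. sum_matrix $ k $ j * difference_matrix $ j $ i)
        = sum_matrix $ k $ i - (case sc i of None \<Rightarrow> 0 | Some p \<Rightarrow> sum_matrix $ k $ p)"
      using False by (simp add: difference_matrix_def right_diff_distrib sum_subtractf
          sum_of_bool_Some sum_of_bool_eq)
    also have "\<dots> = of_bool (k \<in> {i..}) - of_bool (k \<in> above_hat (sc i))"
      using False sc_edge[of i] sc_not_in_D[OF False] by (auto simp: sum_matrix_def split: option.split)
    also have "\<dots> = of_bool (k = i)"
      using not_in_above[of i] unfolding atLeast_not_D[OF False] by auto
    finally show ?thesis .
  qed
  then show ?thesis by (simp add: vec_eq_iff matrix_matrix_mult_def mat_def)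
qed

lemma det_difference_matrix: "det difference_matrix = 1 \<or> det difference_matrix = - 1"
proof -
  have "det sum_matrix * det difference_matrix = 1"
    by (metis det_I det_mul sum_matrix_inverse)
  then show ?thesis by (auto simp: zmult_eq_1_iff)
qed

lemma surj_difference_map: "surj difference_map"
proof -
  let ?A = "map_matrix real_of_int difference_matrix"
  have "invertible ?A"
    using det_difference_matrix by (auto simp: invertible_det_nz det_map_matrix_of_int)
  then obtain B where B: "B ** ?A = mat 1" unfolding invertible_def by blast
  show ?thesis
  proof (rule surjI)
    fix v
    show "difference_map
        ((v - (\<chi> i. real_of_int ((\<chi> i. of_bool (i \<in> D \<and> pr i = None)) $ i))) v* B) = v"
      unfolding difference_map_affine by (simp add: vector_matrix_mul_assoc B)
  qed
qed

lemma unimodularly_equivalent_order_chain: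
  "unimodularly_equivalent (order_polytope :: (real ^ 'n::{finite,order}) set) chain_polytope"
proof -
  have "chain_polytope = difference_map ` order_polytope"
  proof (intro equalityI subsetI)
    fix b :: "real ^ 'n::{finite,order}" assume "b \<in> chain_polytope"
    moreover obtain a where "b = difference_map a" using surj_difference_map by (rule surjE)
    ultimately show "b \<in> difference_map ` order_polytope"
      by (simp add: difference_map_in_chain_polytope_iff)
  qed (auto simp: difference_map_in_chain_polytope_iff)
  then show ?thesis
    unfolding unimodularly_equivalent_def difference_map_affine[abs_def]
    using det_difference_matrix by blast
qed

end

text \<open>
  Without \<open>X\<close> every element has a chain strictly below it or a chain strictly above it, so the
  elements with a chain below them form a suitable down-set.
\<close>

lemma unimodularly_equivalent_if_X_free:
  assumes "\<not> (\<exists>a b c p q :: 'n::{finite,order}. a < c \<and> b < c \<and> c < p \<and> c < q \<and>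
               \<not> a \<le> b \<and> \<not> b \<le> a \<and> \<not> p \<le> q \<and> \<not> q \<le> p)"
  shows "unimodularly_equivalent (order_polytope :: (real ^ 'n::{finite,order}) set) chain_polytope"
proof -
  obtain pr sc :: "'n \<Rightarrow> 'n option"
    where edges: "\<And>i. hat_edge (pr i) (Some i)" "\<And>i. hat_edge (Some i) (sc i)"
    using ex_hat_edge_below ex_hat_edge_above by metis
  interpret forest_partition "{i. is_chain {..<i}}" pr sc
  proof
    show "is_chain {i<..}" if "i \<notin> {i. is_chain {..<i}}" for i :: 'n
      using assms that by simp blast
  qed (use edges in auto)
  show ?thesis by (rule unimodularly_equivalent_order_chain)
qed

theorem theorem2p1:
  shows "unimodularly_equivalent
           (order_polytope :: (real ^ 'n::{finite,order}) set)
           (chain_polytope :: (real ^ 'n::{finite,order}) set)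
         \<longleftrightarrow>
         \<not> (\<exists>a b c p q :: 'n::{finite,order}.
               a < c \<and> b < c \<and> c < p \<and> c < q \<and>
               \<not> a \<le> b \<and> \<not> b \<le> a \<and>
               \<not> p \<le> q \<and> \<not> q \<le> p)"
  using unimodularly_equivalent_if_X_free facets_le_if_unimodularly_equivalent[where 'n = 'n]
    card_hat_edges_less[where 'a = 'n] by (metis not_le)

end
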